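(* For every integer $n\ge 0$, the Hankel determinant $H_{n}\big(B_{2k}(\tfrac{1+x}{2})\big)=\det_{0\le i,j\le n}\big(B_{2(i+j)}(\tfrac{1+x}{2})\big)$ is a polynomial in $x$ of degree exactly $n(n+1)$, and its leading coefficient is \[ \big[x^{n(n+1)}\big]H_{n}\left(B_{2k}\left(\frac{1+x}{2}\right)\right)=(-1)^{\binom{n+1}{2}}\prod_{j=1}^{n}\frac{(j!)^{6}}{(2j)!\,(2j+1)!}. \]
   Context: The Bernoulli polynomials $B_k(x)$ are defined by $\frac{te^{xt}}{e^t-1}=\sum_{k\ge0}B_k(x)\frac{t^k}{k!}$. For a sequence $(a_k)_{k\ge0}$, its $n$-th Hankel determinant is $H_n(a_k):=\det_{0\le i,j\le n}(a_{i+j})$. The notation $[x^m]P(x)$ denotes the coefficient of $x^m$ in the polynomial $P(x)$. *)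

theory Defs
  imports "HOL-Computational_Algebra.Computational_Algebra" "Jordan_Normal_Form.Determinant"
begin

text \<open>
  The series \<open>t e^(xt) / (e^t - 1)\<close>, as a formal power series in \<open>t\<close> over \<open>\<real>[x]\<close>. As the
  division is not available over \<open>\<real>[x]\<close>, the factor \<open>t / (e^t - 1)\<close> is formed
  over \<open>\<real>\<close> and its coefficients are embedded as constant polynomials; the other factor is
  \<open>e^(xt) = \<Sum>k. x^k t^k / k!\<close>.
\<close>

definition bernoulli_gf :: "real poly fps" where
  "bernoulli_gf =
     Abs_fps (\<lambda>k. [:fps_nth (fps_X / (fps_exp 1 - 1)) k:]) * Abs_fps (\<lambda>k. Polynomial.monom (1 / fact k) k)"

definition bernoulli_poly :: "nat \<Rightarrow> real poly" where
  "bernoulli_poly k = Polynomial.smult (fact k) (fps_nth bernoulli_gf k)"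

definition hankel_det :: "nat \<Rightarrow> (nat \<Rightarrow> 'a::comm_ring_1) \<Rightarrow> 'a" where
  "hankel_det n a = det (mat (n + 1) (n + 1) (\<lambda>(i, j). a (i + j)))"

lemma bernoulli_poly_generating_function:
  "Abs_fps (\<lambda>k. poly (bernoulli_poly k) x / fact k) = fps_X * fps_exp x / (fps_exp 1 - 1)"
proof -
  let ?D = "fps_exp 1 - 1 :: real fps"
  have nz: "?D \<noteq> 0"
  proof
    assume "?D = 0"
    then have "fps_nth ?D 1 = 0" by (metis fps_zero_nth)
    then show False by simp
  qed
  have "subdegree ?D = 1"
    by (rule subdegreeI) auto
  then have dvd: "?D dvd fps_X"
    using nz by (simp add: fps_dvd_iff)
  have "Abs_fps (\<lambda>k. poly (bernoulli_poly k) x / fact k) = (fps_X / ?D) * fps_exp x"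
    by (rule fps_ext)
      (simp add: bernoulli_poly_def bernoulli_gf_def fps_mult_nth poly_sum poly_monom)
  also have "\<dots> = fps_X * fps_exp x / ?D"
    using dvd by (simp add: div_mult_swap mult.commute)
  finally show ?thesis .
qed

end

theory Submission imports Defs begin

text \<open>
  Let \<open>\<Phi>\<close> be the functional on \<open>\<real>[t]\<close> with \<open>\<Phi>(t^k) = B_k(0)\<close>, and put \<open>g = t + 1/2\<close>. Then
  \<open>B_{2k}((1+x)/2) = \<Phi>((g + x/2)^{2k})\<close>, and since a Hankel determinant of moments does not change
  under a translation, \<open>(g + x/2)^2\<close> may be replaced by \<open>(g + x/2)^2 - x^2/4 = x g + g^2\<close>. The moment
  \<open>\<Phi>((x g + g^2)^k)\<close> has degree at most \<open>k\<close> in \<open>x\<close> and its coefficient of \<open>x^k\<close> is \<open>\<Phi>(g^k)\<close>, so the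
  coefficient of \<open>x^{n(n+1)}\<close> is the Hankel determinant of \<open>\<Phi>(g^k)\<close>, which by another
  translation is that of the Bernoulli numbers. The latter is evaluated in the bases
  \<open>p_i = t(t-1)\<cdots>(t-i+1)\<close> and \<open>q_j = (t+1)\<cdots>(t+j)\<close>: the product \<open>p_i q_j\<close> is again a
  falling factorial, and \<open>\<Phi>(f(t+1)) - \<Phi>(f) = f'(0)\<close> gives
  \<open>\<Phi>(p_i q_j) = (-1)^i i! j!/(i+j+1)\<close>, a rescaled Hilbert matrix.
\<close>

section \<open>Determinant identities: scaling, transposition, pivoting\<close>

lemma det_scale_rows_cols:
  "det (mat n n (\<lambda>(i, j). r i * c j * f i j)) =
    (\<Prod>i<n. r i) * (\<Prod>i<n. c i) * det (mat n n (\<lambda>(i, j). f i j :: 'a :: comm_ring_1))"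
proof -
  have "(\<Prod>i = 0..<n. r i * c (p i) * f i (p i)) =
      (\<Prod>i<n. r i) * (\<Prod>i<n. c i) * (\<Prod>i = 0..<n. f i (p i))"
    if p: "p permutes {0..<n}" for p
  proof -
    \<comment> \<open>A permutation meets every column once, so the column factors do not depend on
      \<open>p\<close>.\<close>
    have "(\<Prod>i = 0..<n. c (p i)) = (\<Prod>i<n. c i)"
      using prod.permute[OF p, of c] by (simp add: o_def lessThan_atLeast0)
    then show ?thesis
      by (simp add: prod.distrib lessThan_atLeast0)
  qed
  then show ?thesis
    by (subst (1 2) det_def'[where n = n])
      (auto simp: sum_distrib_left permutes_in_image mult_ac intro!: sum.cong)
qed

lemma det_mat_swap_indices:
  "det (mat n n (\<lambda>(i, j). f i j)) = det (mat n n (\<lambda>(i, j). f j i :: 'a :: comm_ring_1))"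
proof -
  have "transpose_mat (mat n n (\<lambda>(i, j). f i j)) = mat n n (\<lambda>(i, j). f j i)"
    by (rule eq_matI) auto
  then show ?thesis
    by (metis det_transpose mat_carrier)
qed

text \<open>Schur complement, from a factorization into a block upper unitriangular and a block
  lower triangular matrix. Pivoting on the last entry lets the remaining rows and columns keep their
  indices, which suits induction on n.\<close>

lemma det_last_pivot:
  fixes f :: "nat \<Rightarrow> nat \<Rightarrow> 'a :: field"
  assumes "f n n \<noteq> 0"
  shows "det (mat (Suc n) (Suc n) (\<lambda>(i, j). f i j)) =
    f n n * det (mat n n (\<lambda>(i, j). f i j - f i n * f n j / f n n))"
proof -
  let ?u = "mat n 1 (\<lambda>(i, j). f i n / f n n)"
  let ?U = "four_block_mat (1\<^sub>m n) ?u (0\<^sub>m 1 n) (1\<^sub>m 1)"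
  let ?S = "mat n n (\<lambda>(i, j). f i j - f i n * f n j / f n n)"
  let ?v = "mat 1 n (\<lambda>(i, j). f n j)"
  let ?d = "mat 1 1 (\<lambda>(i, j). f n n)"
  let ?L = "four_block_mat ?S (0\<^sub>m n 1) ?v ?d"
  have "?U * ?L = four_block_mat (1\<^sub>m n * ?S + ?u * ?v) (1\<^sub>m n * 0\<^sub>m n 1 + ?u * ?d)
      (0\<^sub>m 1 n * ?S + 1\<^sub>m 1 * ?v) (0\<^sub>m 1 n * 0\<^sub>m n 1 + 1\<^sub>m 1 * ?d)"
    by (rule mult_four_block_mat) auto
  also have "\<dots> = mat (Suc n) (Suc n) (\<lambda>(i, j). f i j)"
    using assms by (intro eq_matI) (auto simp: scalar_prod_def less_Suc_eq)
  finally have "det (mat (Suc n) (Suc n) (\<lambda>(i, j). f i j)) = det (?U * ?L)"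
    by simp
  also have "\<dots> = det ?U * det ?L"
    by (rule det_mult[where n = "n + 1"]) auto
  also have "det ?U = 1"
    by (subst det_four_block_mat_lower_left_zero[where n = n and m = 1]) auto
  also have "det ?L = det ?S * f n n"
    by (subst det_four_block_mat_upper_right_zero[where n = n and m = 1]) (auto simp: det_single)
  finally show ?thesis
    by simp
qed

section \<open>Determinant of the Hilbert matrix\<close>

definition hilbert_mat :: "nat \<Rightarrow> real mat" where
  "hilbert_mat n = mat n n (\<lambda>(i, j). 1 / real (i + j + 1))"

lemma prod_hilbert_factor:
  "(\<Prod>i<n. (real n - real i) / (real i + real n + 1)) = (fact n)\<^sup>2 / fact (2 * n)"
proof -
  have "(\<Prod>i<n. real n - real i) = (\<Prod>i<n. real (Suc i))"
    by (rule prod.reindex_bij_witness[of _ "\<lambda>i. n - Suc i" "\<lambda>i. n - Suc i"]) auto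
  also have "\<dots> = fact n"
    by (induction n) (auto simp: fact_Suc)
  finally have 1: "(\<Prod>i<n. real n - real i) = fact n" .
  \<comment> \<open>The number of factors k is separated from n, so that n stays fixed in the
    induction.\<close>
  have "fact n * (\<Prod>i<k. real i + real n + 1) = fact (n + k)" for k
  proof (induction k)
    case (Suc k)
    have "fact n * (\<Prod>i<Suc k. real i + real n + 1) =
        fact n * (\<Prod>i<k. real i + real n + 1) * (real k + real n + 1)"
      by simp
    then show ?case
      by (simp only: Suc) (simp add: algebra_simps)
  qed simp
  from this[of n] have "(\<Prod>i<n. real i + real n + 1) = fact (2 * n) / fact n"
    by (simp add: field_simps flip: mult_2)
  with 1 show ?thesis
    by (simp add: prod_dividef power2_eq_square)
qed

text \<open>After pivoting on the last entry 1/(2n+1), the Schur complement has entries r_i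
  r_j/(i+j+1): it is the smaller Hilbert matrix with rows and columns rescaled. The product of the
  r_i is \<open>prod_hilbert_factor\<close>.\<close>

lemma det_hilbert_mat:
  "det (hilbert_mat n) = (\<Prod>k<n. fact k ^ 4 / (fact (2 * k) * fact (2 * k + 1)))"
proof (induction n)
  case 0
  then show ?case
    by (simp add: hilbert_mat_def)
next
  case (Suc n)
  let ?r = "\<lambda>i. (real n - real i) / (real i + real n + 1)"
  have "1 / real (i + j + 1) - 1 / real (i + n + 1) * (1 / real (n + j + 1)) / (1 / real (n + n + 1)) =
      ?r i * ?r j * (1 / real (i + j + 1))" for i j
  proof -
    have "real i + real j + 1 \<noteq> 0" "real i + real n + 1 \<noteq> 0" "real j + real n + 1 \<noteq> 0"
      by linarith+
    then show ?thesis
      by (simp add: divide_simps) (simp add: algebra_simps)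
  qed
  then have "det (hilbert_mat (Suc n)) =
      1 / real (n + n + 1) * det (mat n n (\<lambda>(i, j). ?r i * ?r j * (1 / real (i + j + 1))))"
    unfolding hilbert_mat_def by (subst det_last_pivot) auto
  also have "\<dots> = 1 / real (n + n + 1) * ((fact n)\<^sup>2 / fact (2 * n))\<^sup>2 * det (hilbert_mat n)"
    unfolding det_scale_rows_cols prod_hilbert_factor hilbert_mat_def by (simp add: power2_eq_square)
  also have "1 / real (n + n + 1) * ((fact n)\<^sup>2 / fact (2 * n))\<^sup>2 =
      fact n ^ 4 / (fact (2 * n) * fact (2 * n + 1))"
    by (simp add: power_divide flip: power_mult) (simp add: power2_eq_square mult_ac mult_2)
  finally show ?case
    using Suc by simp
qed

section \<open>Degree and top coefficient of a Hankel determinant of polynomials\<close>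

lemma coeff_mult_degree_bounds:
  fixes p q :: "'a :: comm_semiring_0 poly"
  assumes "degree p \<le> m" "degree q \<le> k"
  shows "Polynomial.coeff (p * q) (m + k) = Polynomial.coeff p m * Polynomial.coeff q k"
proof (cases "degree p = m \<and> degree q = k")
  case True
  then show ?thesis
    by (auto simp: coeff_mult_degree_sum)
next
  case False
  with assms have "degree p < m \<or> degree q < k" "degree p + degree q < m + k"
    by auto
  moreover have "degree (p * q) \<le> degree p + degree q"
    by (rule degree_mult_le)
  ultimately show ?thesis
    by (auto simp: coeff_eq_0)
qed

lemma degree_coeff_prod:
  fixes f :: "'b \<Rightarrow> 'a :: comm_ring_1 poly"
  assumes "finite S" "\<And>i. i \<in> S \<Longrightarrow> degree (f i) \<le> d i"
  shows "degree (\<Prod>i\<in>S. f i) \<le> (\<Sum>i\<in>S. d i)"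
    and "Polynomial.coeff (\<Prod>i\<in>S. f i) (\<Sum>i\<in>S. d i) = (\<Prod>i\<in>S. Polynomial.coeff (f i) (d i))"
proof -
  \<comment> \<open>Both claims go through one induction, since the coefficient step needs the
    degree bound for the partial product.\<close>
  have "degree (\<Prod>i\<in>S. f i) \<le> (\<Sum>i\<in>S. d i) \<and>
      Polynomial.coeff (\<Prod>i\<in>S. f i) (\<Sum>i\<in>S. d i) = (\<Prod>i\<in>S. Polynomial.coeff (f i) (d i))"
    using assms
  proof (induction S rule: finite_induct)
    case empty
    then show ?case by simp
  next
    case (insert x S)
    then have *: "degree (f x) \<le> d x" "degree (\<Prod>i\<in>S. f i) \<le> (\<Sum>i\<in>S. d i)"
      by auto
    from order.trans[OF degree_mult_le add_mono[OF *]] coeff_mult_degree_bounds[OF *] insert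
    show ?case by simp
  qed
  then show "degree (\<Prod>i\<in>S. f i) \<le> (\<Sum>i\<in>S. d i)"
    "Polynomial.coeff (\<Prod>i\<in>S. f i) (\<Sum>i\<in>S. d i) = (\<Prod>i\<in>S. Polynomial.coeff (f i) (d i))"
    by auto
qed

lemma sum_add_permuted:
  assumes "p permutes {0..<Suc n}"
  shows "(\<Sum>i = 0..<Suc n. i + p i) = n * (n + 1)"
proof -
  have "(\<Sum>i = 0..<Suc n. p i) = (\<Sum>i = 0..<Suc n. i)"
    using sum.permute[OF assms, of "\<lambda>i. i"] by (simp add: o_def)
  moreover have "2 * (\<Sum>i = 0..<Suc n. i) = n * (n + 1)"
    by (induction n) auto
  ultimately show ?thesis
    by (simp only: sum.distrib)
qed

text \<open>In the Leibniz expansion the term of p has degree at most the sum of all i + p(i), which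
  is n(n+1) for every permutation. The coefficient at this common bound can therefore be taken
  entrywise.\<close>

lemma degree_coeff_hankel_det:
  fixes c :: "nat \<Rightarrow> 'a :: comm_ring_1 poly"
  assumes "\<And>k. degree (c k) \<le> k"
  shows "degree (hankel_det n c) \<le> n * (n + 1)"
    and "Polynomial.coeff (hankel_det n c) (n * (n + 1)) =
      hankel_det n (\<lambda>k. Polynomial.coeff (c k) k)"
proof -
  let ?P = "{p. p permutes {0..<Suc n}}"
  have less: "p i < Suc n" if "p \<in> ?P" "i < Suc n" for p i
    using permutes_in_image[of p "{0..<Suc n}" i] that by simp
  have eq: "hankel_det n c = (\<Sum>p\<in>?P. signof p * (\<Prod>i = 0..<Suc n. c (i + p i)))"
    for c :: "nat \<Rightarrow> 'b :: comm_ring_1"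
    unfolding hankel_det_def
    by (subst det_def'[where n = "Suc n"])
      (auto simp: less intro!: sum.cong prod.cong arg_cong2[where f = "(*)"] simp del: prod.op_ivl_Suc)
  have signof_poly: "signof p * q = Polynomial.smult (signof p) q" for p :: "nat \<Rightarrow> nat" and q :: "'a poly"
    by (cases p rule: sign_cases) auto
  have *: "degree (\<Prod>i = 0..<Suc n. c (i + p i)) \<le> n * (n + 1)"
    "Polynomial.coeff (\<Prod>i = 0..<Suc n. c (i + p i)) (n * (n + 1)) =
      (\<Prod>i = 0..<Suc n. Polynomial.coeff (c (i + p i)) (i + p i))" if "p \<in> ?P" for p
    using degree_coeff_prod[of "{0..<Suc n}" "\<lambda>i. c (i + p i)" "\<lambda>i. i + p i"] assms
      sum_add_permuted[of p n] that by (simp_all del: sum.op_ivl_Suc prod.op_ivl_Suc)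
  show "degree (hankel_det n c) \<le> n * (n + 1)"
    unfolding eq signof_poly
    by (intro degree_sum_le order.trans[OF degree_smult_le] *(1)) (auto simp: finite_permutations)
  show "Polynomial.coeff (hankel_det n c) (n * (n + 1)) =
      hankel_det n (\<lambda>k. Polynomial.coeff (c k) k)"
    unfolding eq signof_poly coeff_sum coeff_smult
    by (intro sum.cong refl) (simp only: *(2))
qed

lemma poly_hankel_det:
  "poly (hankel_det n c) x = hankel_det n (\<lambda>k. poly (c k) (x :: 'a :: comm_ring_1))"
proof -
  interpret comm_ring_hom "\<lambda>p. poly p x"
    by unfold_locales auto
  show ?thesis
    unfolding hankel_det_def hom_det[symmetric]
    by (intro arg_cong[where f = det] eq_matI) auto
qed

section \<open>Linear functionals on polynomials and their Hankel determinants\<close>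

locale poly_functional =
  fixes L :: "'a :: comm_ring_1 poly \<Rightarrow> 'a"
  assumes add: "L (p + q) = L p + L q"
    and smult: "L (Polynomial.smult c p) = c * L p"
begin

lemma zero: "L 0 = 0"
  using smult[of 0 0] by simp

lemma sum: "L (\<Sum>i\<in>S. f i) = (\<Sum>i\<in>S. L (f i))"
  by (induction S rule: infinite_finite_induct) (auto simp: zero add)

text \<open>With N fixed, the sum is an entry of a matrix product, as needed for a change of basis.
  With q = 1 it shows that the moments determine the functional.\<close>

lemma expand_left:
  assumes "degree p < N"
  shows "L (p * q) = (\<Sum>k<N. Polynomial.coeff p k * L ([:0, 1:] ^ k * q))"
proof -
  have "p = (\<Sum>k\<le>N - 1. Polynomial.monom (Polynomial.coeff p k) k)"
    using assms by (intro poly_as_sum_of_monoms'[symmetric]) auto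
  also have "{..N - 1} = {..<N}"
    using assms by auto
  finally have "p * q = (\<Sum>k<N. Polynomial.smult (Polynomial.coeff p k) ([:0, 1:] ^ k * q))"
    by (metis (no_types, lifting) monom_altdef mult_smult_left sum.cong sum_distrib_right)
  then show ?thesis
    by (simp only: sum smult)
qed

text \<open>The change of basis is multiplication by the coefficient matrix of the
  \<open>p i\<close>, which is lower triangular with unit diagonal because they are monic of degree
  i.\<close>

lemma det_change_basis_left:
  assumes "\<And>i. degree (p i) = i" "\<And>i. Polynomial.coeff (p i) i = 1"
  shows "det (mat N N (\<lambda>(i, j). L (p i * q j))) = det (mat N N (\<lambda>(i, j). L ([:0, 1:] ^ i * q j)))"
proof -
  let ?P = "mat N N (\<lambda>(i, j). Polynomial.coeff (p i) j)"
  let ?M = "mat N N (\<lambda>(i, j). L ([:0, 1:] ^ i * q j))"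
  have "mat N N (\<lambda>(i, j). L (p i * q j)) = ?P * ?M"
    by (intro eq_matI) (auto simp: scalar_prod_def expand_left[of _ N] assms lessThan_atLeast0)
  moreover have "det ?P = prod_list (diag_mat ?P)"
    by (rule det_lower_triangular[where n = N]) (auto intro: coeff_eq_0 simp: assms)
  moreover have "\<dots> = 1"
    by (auto simp: prod_list_diag_prod assms)
  ultimately show ?thesis
    by (simp add: det_mult[where n = N])
qed

lemma det_change_basis:
  assumes "\<And>i. degree (p i) = i" "\<And>i. Polynomial.coeff (p i) i = 1"
    and "\<And>i. degree (q i) = i" "\<And>i. Polynomial.coeff (q i) i = 1"
  shows "det (mat (n + 1) (n + 1) (\<lambda>(i, j). L (p i * q j))) = hankel_det n (\<lambda>k. L ([:0, 1:] ^ k))"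
proof -
  have "det (mat (n + 1) (n + 1) (\<lambda>(i, j). L (p i * q j))) =
      det (mat (n + 1) (n + 1) (\<lambda>(i, j). L ([:0, 1:] ^ i * q j)))"
    using assms by (intro det_change_basis_left) auto
  \<comment> \<open>Transposing moves the second basis to the left, where the same lemma applies
    again.\<close>
  also have "\<dots> = det (mat (n + 1) (n + 1) (\<lambda>(i, j). L (q i * [:0, 1:] ^ j)))"
    by (subst det_mat_swap_indices) (simp only: mult.commute)
  also have "\<dots> = det (mat (n + 1) (n + 1) (\<lambda>(i, j). L ([:0, 1:] ^ i * [:0, 1:] ^ j)))"
    using assms by (intro det_change_basis_left) auto
  finally show ?thesis
    by (simp only: hankel_det_def power_add)
qed

text \<open>The powers of t + s form a monic basis, and (t+s)^(i+j) is the product of two of its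
  members.\<close>

lemma hankel_det_shift:
  "hankel_det n (\<lambda>k. L ([:s, 1:] ^ k)) = hankel_det n (\<lambda>k. L ([:0, 1:] ^ k))"
proof -
  have "degree ([:s, 1:] ^ i) = i" "Polynomial.coeff ([:s, 1:] ^ i) i = 1" for i
  proof -
    \<comment> \<open>The coefficient ring may have zero divisors, so the degree is obtained from an
      upper bound and this nonzero coefficient.\<close>
    show c: "Polynomial.coeff ([:s, 1:] ^ i) i = 1"
      using degree_coeff_prod(2)[of "{..<i}" "\<lambda>_. [:s, 1:]" "\<lambda>_. 1"] by simp
    have "degree ([:s, 1:] ^ i) \<le> i"
      using degree_coeff_prod(1)[of "{..<i}" "\<lambda>_. [:s, 1:]" "\<lambda>_. 1"] by simp
    with c show "degree ([:s, 1:] ^ i) = i"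
      by (intro antisym le_degree) auto
  qed
  then show ?thesis
    by (subst det_change_basis[symmetric, of "\<lambda>i. [:s, 1:] ^ i" "\<lambda>i. [:s, 1:] ^ i"])
      (simp_all only: hankel_det_def power_add)
qed

lemma linear_power:
  "L ([:y, 1:] ^ k) = (\<Sum>i\<le>k. of_nat (k choose i) * y ^ (k - i) * L ([:0, 1:] ^ i))"
proof -
  have "[:y, 1:] = [:0, 1:] + [:y:]"
    by simp
  then have "[:y, 1:] ^ k = (\<Sum>i\<le>k. of_nat (k choose i) * [:0, 1:] ^ i * [:y:] ^ (k - i))"
    by (simp only: binomial_ring)
  also have "\<dots> = (\<Sum>i\<le>k. Polynomial.smult (of_nat (k choose i) * y ^ (k - i)) ([:0, 1:] ^ i))"
    by (intro sum.cong) (auto simp: of_nat_poly poly_const_pow mult_ac)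
  finally show ?thesis
    by (simp only: sum smult)
qed

end

lemma poly_functional_eqI:
  assumes "poly_functional L" "poly_functional M" "\<And>k. L ([:0, 1:] ^ k) = M ([:0, 1:] ^ k)"
  shows "L p = M p"
  using poly_functional.expand_left[OF assms(1), of p "Suc (degree p)" 1]
    poly_functional.expand_left[OF assms(2), of p "Suc (degree p)" 1] assms(3) by simp

lemma pcompose_power: "pcompose (p ^ k) q = pcompose p q ^ k"
  by (induction k) (simp_all add: pcompose_1 pcompose_mult)

section \<open>The Bernoulli functional \<Phi>\<close>

definition bernoulli_umbra :: "real poly \<Rightarrow> real" where
  "bernoulli_umbra p = (\<Sum>k\<le>degree p. Polynomial.coeff p k * poly (bernoulli_poly k) 0)"

text \<open>Permits a common summation range for polynomials of different degrees, as additivity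
  requires.\<close>

lemma bernoulli_umbra_extend:
  assumes "degree p \<le> N"
  shows "bernoulli_umbra p = (\<Sum>k\<le>N. Polynomial.coeff p k * poly (bernoulli_poly k) 0)"
  unfolding bernoulli_umbra_def using assms
  by (intro sum.mono_neutral_left) (auto simp: coeff_eq_0)

interpretation bernoulli: poly_functional bernoulli_umbra
proof
  fix p q :: "real poly" and c :: real
  have "degree (p + q) \<le> max (degree p) (degree q)"
    by (rule degree_add_le_max)
  then show "bernoulli_umbra (p + q) = bernoulli_umbra p + bernoulli_umbra q"
    by (subst (1 2 3) bernoulli_umbra_extend[of _ "max (degree p) (degree q)"])
      (auto simp: sum.distrib algebra_simps)
  show "bernoulli_umbra (Polynomial.smult c p) = c * bernoulli_umbra p"
    by (subst (1 2) bernoulli_umbra_extend[of _ "degree p"]) (auto simp: sum_distrib_left mult_ac)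
qed

lemma bernoulli_umbra_X_power: "bernoulli_umbra ([:0, 1:] ^ k) = poly (bernoulli_poly k) 0"
proof -
  have "[:0, 1:] ^ k = (Polynomial.monom 1 k :: real poly)"
    by (simp add: monom_altdef)
  moreover have "Polynomial.coeff (Polynomial.monom 1 k) i * poly (bernoulli_poly i) 0 =
      (if i = k then poly (bernoulli_poly k) 0 else 0)" for i
    by auto
  ultimately show ?thesis
    by (simp add: bernoulli_umbra_def degree_monom_eq del: coeff_monom)
qed

lemma subdegree_exp_minus_one: "subdegree (fps_exp 1 - 1 :: real fps) = 1"
  by (rule subdegreeI) auto

lemma exp_minus_one_dvd_X: "(fps_exp 1 - 1 :: real fps) dvd fps_X"
proof -
  have "(fps_exp 1 - 1 :: real fps) \<noteq> 0"
    by (rule notI) (use subdegree_exp_minus_one in \<open>simp only: subdegree_0; simp\<close>)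
  then show ?thesis
    using subdegree_exp_minus_one by (subst fps_dvd_iff) (simp_all only: fps_X_neq_zero subdegree_fps_X not_False_eq_True)
qed

text \<open>Isolates the factor that is independent of x, so that the series at different points
  differ only in their exponentials.\<close>

lemma bernoulli_poly_egf:
  "Abs_fps (\<lambda>k. poly (bernoulli_poly k) x / fact k) = fps_X / (fps_exp 1 - 1) * fps_exp x"
  unfolding bernoulli_poly_generating_function mult.commute[of _ "fps_exp x"]
  by (rule div_mult_swap[OF exp_minus_one_dvd_X, symmetric])

text \<open>The series at y is the series at 0 times e^(yt). Comparing coefficients gives the
  binomial expansion of B_k(y) in the B_i(0), which is \<Phi> applied to the expanded power.\<close>

lemma bernoulli_umbra_linear_power: "bernoulli_umbra ([:y, 1:] ^ k) = poly (bernoulli_poly k) y"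
proof -
  have "Abs_fps (\<lambda>k. poly (bernoulli_poly k) y / fact k) =
      Abs_fps (\<lambda>k. poly (bernoulli_poly k) 0 / fact k) * fps_exp y"
    unfolding bernoulli_poly_egf by simp
  from arg_cong[OF this, of "\<lambda>f. fps_nth f k"] have "poly (bernoulli_poly k) y / fact k =
      (\<Sum>i\<le>k. poly (bernoulli_poly i) 0 / fact i * (y ^ (k - i) / fact (k - i)))"
    by (simp add: fps_mult_nth atMost_atLeast0)
  then have "poly (bernoulli_poly k) y =
      fact k * (\<Sum>i\<le>k. poly (bernoulli_poly i) 0 / fact i * (y ^ (k - i) / fact (k - i)))"
    by (metis fact_nonzero nonzero_eq_divide_eq mult.commute)
  also have "\<dots> = (\<Sum>i\<le>k. fact k * (poly (bernoulli_poly i) 0 / fact i * (y ^ (k - i) / fact (k - i))))"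
    by (rule sum_distrib_left)
  also have "\<dots> = (\<Sum>i\<le>k. of_nat (k choose i) * y ^ (k - i) * poly (bernoulli_poly i) 0)"
    by (intro sum.cong) (auto simp: binomial_fact)
  finally show ?thesis
    unfolding bernoulli.linear_power[of y] bernoulli_umbra_X_power by (rule sym)
qed

lemma bernoulli_poly_diff: "poly (bernoulli_poly k) 1 = poly (bernoulli_poly k) 0 + (if k = 1 then 1 else 0)"
proof -
  have "Abs_fps (\<lambda>k. poly (bernoulli_poly k) 1 / fact k) -
      Abs_fps (\<lambda>k. poly (bernoulli_poly k) 0 / fact k) = fps_X / (fps_exp 1 - 1) * (fps_exp 1 - 1)"
    unfolding bernoulli_poly_egf right_diff_distrib by simp
  also have "\<dots> = fps_X"
    by (rule dvd_div_mult_self[OF exp_minus_one_dvd_X])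
  finally have "poly (bernoulli_poly k) 1 / fact k - poly (bernoulli_poly k) 0 / fact k =
      (if k = 1 then 1 else 0)"
    by (simp add: fps_eq_iff)
  then have "poly (bernoulli_poly k) 1 - poly (bernoulli_poly k) 0 = (if k = 1 then 1 else 0) * fact k"
    by (simp add: nonzero_divide_eq_eq flip: diff_divide_distrib)
  then show ?thesis
    by (auto split: if_splits)
qed

text \<open>By linearity it suffices to test powers of t, where the claim reads B_k(1) - B_k(0) =
  [k = 1]. The added coefficient is the derivative of p at 0.\<close>

lemma bernoulli_umbra_translate:
  "bernoulli_umbra (pcompose p [:1, 1:]) = bernoulli_umbra p + Polynomial.coeff p 1"
proof (rule poly_functional_eqI)
  show "poly_functional (\<lambda>p. bernoulli_umbra (pcompose p [:1, 1:]))"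
    by unfold_locales (simp_all add: pcompose_add pcompose_smult bernoulli.add bernoulli.smult)
  show "poly_functional (\<lambda>p. bernoulli_umbra p + Polynomial.coeff p 1)"
    by unfold_locales (simp_all add: bernoulli.add bernoulli.smult algebra_simps)
  fix k
  have "pcompose ([:0, 1:] ^ k) [:1, 1:] = ([:1, 1:] ^ k :: real poly)"
    by (simp add: pcompose_power pcompose_pCons)
  moreover have "Polynomial.coeff ([:0, 1:] ^ k) 1 = (if k = 1 then 1 else 0 :: real)"
    using coeff_monom[of "1 :: real" k 1] by (simp add: monom_altdef)
  ultimately show "bernoulli_umbra (pcompose ([:0, 1:] ^ k) [:1, 1:]) =
      bernoulli_umbra ([:0, 1:] ^ k) + Polynomial.coeff ([:0, 1:] ^ k) 1"
    by (simp add: bernoulli_umbra_linear_power bernoulli_umbra_X_power bernoulli_poly_diff)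
qed

section \<open>Falling factorials in t + a and the Hankel determinant of the Bernoulli
  numbers\<close>

definition falling :: "real \<Rightarrow> nat \<Rightarrow> real poly" where
  "falling a k = (\<Prod>l<k. [:a - real l, 1:])"

lemma degree_falling: "degree (falling a k) = k"
  by (simp add: falling_def degree_prod_eq_sum_degree)

lemma coeff_falling: "Polynomial.coeff (falling a k) k = 1"
  using degree_coeff_prod(2)[of "{..<k}" "\<lambda>l. [:a - real l, 1:]" "\<lambda>_. 1"] by (simp add: falling_def)

lemma falling_add: "falling a (j + i) = falling a j * falling (a - real j) i"
  by (induction i) (simp_all add: falling_def algebra_simps)

lemma falling_shift: "pcompose (falling a k) [:1, 1:] = falling (a + 1) k"
  by (simp add: falling_def pcompose_prod pcompose_pCons algebra_simps)

text \<open>Both products contain \<open>falling a k\<close>; the remaining factors t + a + 1 and t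
  + a - k differ by k + 1.\<close>

lemma falling_diff: "falling (a + 1) (Suc k) - falling a (Suc k) = Polynomial.smult (real (Suc k)) (falling a k)"
proof -
  have "falling (a + 1) (Suc k) = [:a + 1, 1:] * falling a k"
    using falling_add[of "a + 1" 1 k] by (simp add: falling_def)
  moreover have "falling a (Suc k) = [:a - real k, 1:] * falling a k"
    by (simp add: falling_def)
  ultimately show ?thesis
    by (simp add: algebra_simps flip: smult_add_left smult_diff_left)
qed

text \<open>By \<open>falling_diff\<close>, \<open>falling a k\<close> is the forward difference of
  \<open>falling a (Suc k)\<close> divided by k + 1, so the translation rule evaluates it.\<close>

lemma bernoulli_umbra_falling:
  "bernoulli_umbra (falling a k) = Polynomial.coeff (falling a (Suc k)) 1 / real (Suc k)"
proof -
  have "real (Suc k) * bernoulli_umbra (falling a k) =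
      bernoulli_umbra (falling (a + 1) (Suc k) - falling a (Suc k))"
    by (simp only: falling_diff bernoulli.smult)
  also have "\<dots> = bernoulli_umbra (falling (a + 1) (Suc k)) - bernoulli_umbra (falling a (Suc k))"
    using bernoulli.add[of "falling (a + 1) (Suc k) - falling a (Suc k)" "falling a (Suc k)"] by simp
  also have "\<dots> = Polynomial.coeff (falling a (Suc k)) 1"
    using bernoulli_umbra_translate[of "falling a (Suc k)"] by (simp add: falling_shift)
  finally show ?thesis
    by (simp add: field_simps)
qed

lemma poly_falling_0: "poly (falling (real j) j) 0 = fact j" "poly (falling (- 1) i) 0 = (- 1) ^ i * fact i"
proof -
  have "(\<Prod>l<j. real j - real l) = (\<Prod>l<j. real (Suc l))"
    by (rule prod.reindex_bij_witness[of _ "\<lambda>i. j - Suc i" "\<lambda>i. j - Suc i"]) auto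
  also have "\<dots> = fact j"
    by (induction j) auto
  finally show "poly (falling (real j) j) 0 = fact j"
    by (simp add: falling_def poly_prod)
  show "poly (falling (- 1) i) 0 = (- 1) ^ i * fact i"
    by (induction i) (simp_all add: falling_def algebra_simps)
qed

lemma bernoulli_umbra_falling_mult:
  "bernoulli_umbra (falling 0 i * falling (real j) j) =
    ((- 1) ^ i * fact i) * fact j * (1 / real (i + j + 1))"
proof -
  \<comment> \<open>The factors run from t + j down to t - i. Splitting off the factor t leaves
    (t+j)...(t+1) and (t-1)...(t-i), whose values at 0 are j! and (-1)^i i!; their product is the
    coefficient of t.\<close>
  have "falling (real j) (Suc (j + i)) = [:0, 1:] * (falling (real j) j * falling (- 1) i)"
    using falling_add[of "real j" j "Suc i"] falling_add[of 0 1 i]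
    by (simp add: falling_def mult_ac)
  then have "Polynomial.coeff (falling (real j) (Suc (j + i))) 1 =
      poly (falling (real j) j * falling (- 1) i) 0"
    by (simp add: poly_0_coeff_0)
  then have "Polynomial.coeff (falling (real j) (Suc (j + i))) 1 = (- 1) ^ i * fact i * fact j"
    by (simp add: poly_falling_0)
  moreover have "falling 0 i * falling (real j) j = falling (real j) (j + i)"
    by (simp add: falling_add)
  ultimately show ?thesis
    by (simp add: bernoulli_umbra_falling add_ac)
qed

lemma hankel_det_bernoulli_number:
  "hankel_det n (\<lambda>k. bernoulli_umbra ([:0, 1:] ^ k)) =
    (-1) ^ ((n + 1) choose 2) * (\<Prod>j = 1..n. fact j ^ 6 / (fact (2 * j) * fact (2 * j + 1)))"
proof -
  have "hankel_det n (\<lambda>k. bernoulli_umbra ([:0, 1:] ^ k)) =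
      det (mat (n + 1) (n + 1) (\<lambda>(i, j). bernoulli_umbra (falling 0 i * falling (real j) j)))"
    by (rule bernoulli.det_change_basis[symmetric]) (auto simp: degree_falling coeff_falling)
  also have "\<dots> = (\<Prod>i<n + 1. (- 1) ^ i * fact i) * (\<Prod>j<n + 1. fact j) * det (hilbert_mat (n + 1))"
    unfolding bernoulli_umbra_falling_mult hilbert_mat_def by (rule det_scale_rows_cols)
  \<comment> \<open>Row and column factors supply (k!)^2 and the Hilbert determinant supplies
    (k!)^4.\<close>
  also have "\<dots> = (\<Prod>k<n + 1. (- 1) ^ k) * (\<Prod>k<n + 1. fact k ^ 6 / (fact (2 * k) * fact (2 * k + 1)))"
    unfolding det_hilbert_mat prod.distrib[symmetric]
    by (intro prod.cong) (simp_all add: power_numeral_reduce)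
  also have "(\<Prod>k<n + 1. (- 1) ^ k) = (- 1 :: real) ^ ((n + 1) choose 2)"
    by (induction n) (simp_all add: numeral_2_eq_2 power_add)
  \<comment> \<open>The factor at k = 0 equals 1.\<close>
  also have "(\<Prod>k<n + 1. fact k ^ 6 / (fact (2 * k) * fact (2 * k + 1))) =
      (\<Prod>k = 1..n. fact k ^ 6 / (fact (2 * k) * fact (2 * k + 1)) :: real)"
    by (induction n) simp_all
  finally show ?thesis .
qed

section \<open>Reduction of the even Bernoulli polynomials to moments of low degree in x\<close>

definition shifted_moment :: "nat \<Rightarrow> real poly" where
  "shifted_moment k =
    (\<Sum>m\<le>k. Polynomial.monom (real (k choose m) * bernoulli_umbra ([:1 / 2, 1:] ^ (2 * k - m))) m)"

lemma degree_shifted_moment: "degree (shifted_moment k) \<le> k"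
  unfolding shifted_moment_def by (intro degree_sum_le) (auto intro: order.trans[OF degree_monom_le])

lemma coeff_shifted_moment:
  "Polynomial.coeff (shifted_moment k) k = bernoulli_umbra ([:1 / 2, 1:] ^ k)"
  by (simp add: shifted_moment_def coeff_sum)

text \<open>As \<Phi> acts on real polynomials, x enters \<open>shifted_moment\<close> only through
  the binomial expansion: the term with (xg)^m carries g^(m + 2(k-m)), whence the exponent 2k -
  m.\<close>

lemma poly_shifted_moment:
  "poly (shifted_moment k) x =
    bernoulli_umbra ((Polynomial.smult x [:1 / 2, 1:] + [:1 / 2, 1:]\<^sup>2) ^ k)"
proof -
  define g :: "real poly" where "g = [:1 / 2, 1:]"
  have "(Polynomial.smult x g + g\<^sup>2) ^ k =
      (\<Sum>m\<le>k. of_nat (k choose m) * Polynomial.smult x g ^ m * (g\<^sup>2) ^ (k - m))"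
    by (rule binomial_ring)
  also have "\<dots> = (\<Sum>m\<le>k. Polynomial.smult (x ^ m * real (k choose m)) (g ^ (2 * k - m)))"
  proof (intro sum.cong refl)
    fix m assume "m \<in> {..k}"
    then have "2 * k - m = m + 2 * (k - m)"
      by auto
    then show "of_nat (k choose m) * Polynomial.smult x g ^ m * (g\<^sup>2) ^ (k - m) =
        Polynomial.smult (x ^ m * real (k choose m)) (g ^ (2 * k - m))"
      by (simp add: of_nat_poly smult_power power_add power_mult)
  qed
  finally show ?thesis
    by (simp only: bernoulli.sum bernoulli.smult flip: g_def)
      (simp add: shifted_moment_def poly_sum poly_monom mult_ac g_def)
qed

text \<open>At a fixed real x, both sequences are values of the single functional p \<mapsto>
  \<Phi>(p(h)) with h = (t + (1+x)/2)^2, on the powers of t and of t - x^2/4, so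
  \<open>hankel_det_shift\<close> applies to it.\<close>

lemma hankel_det_shifted_moment:
  "hankel_det n (\<lambda>k. pcompose (bernoulli_poly (2 * k)) [:1 / 2, 1 / 2:]) = hankel_det n shifted_moment"
proof (subst poly_eq_poly_eq_iff[symmetric], rule ext)
  fix x :: real
  let ?h = "[:(1 + x) / 2, 1:]\<^sup>2"
  interpret M: poly_functional "\<lambda>p. bernoulli_umbra (pcompose p ?h)"
    by unfold_locales (simp_all add: pcompose_add pcompose_smult bernoulli.add bernoulli.smult)
  have pow: "pcompose ([:s, 1:] ^ k) ?h = ([:s:] + ?h) ^ k" for s k
    by (simp add: pcompose_power pcompose_pCons)
  have "poly (pcompose (bernoulli_poly (2 * k)) [:1 / 2, 1 / 2:]) x =
      bernoulli_umbra (pcompose ([:0, 1:] ^ k) ?h)" for k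
  proof -
    have "poly (pcompose (bernoulli_poly (2 * k)) [:1 / 2, 1 / 2:]) x =
        poly (bernoulli_poly (2 * k)) ((1 + x) / 2)"
      by (simp add: poly_pcompose add_divide_distrib)
    then show ?thesis
      by (simp add: pow power_mult flip: bernoulli_umbra_linear_power)
  qed
  moreover have "poly (shifted_moment k) x = bernoulli_umbra (pcompose ([:- (x\<^sup>2 / 4), 1:] ^ k) ?h)" for k
  proof -
    \<comment> \<open>The shift is chosen to cancel the x^2 term of h, leaving an expression linear
      in x.\<close>
    have "[:- (x\<^sup>2 / 4):] + ?h = Polynomial.smult x [:1 / 2, 1:] + [:1 / 2, 1:]\<^sup>2"
      by (simp add: power2_eq_square field_simps)
    then show ?thesis
      by (simp only: pow poly_shifted_moment)
  qed
  ultimately show "poly (hankel_det n (\<lambda>k. pcompose (bernoulli_poly (2 * k)) [:1 / 2, 1 / 2:])) x =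
      poly (hankel_det n shifted_moment) x"
    by (simp only: poly_hankel_det M.hankel_det_shift[of n "- (x\<^sup>2 / 4)"])
qed

theorem theorem1p2:
  fixes n :: nat
  shows "let H = hankel_det n (\<lambda>k. pcompose (bernoulli_poly (2 * k)) [:1 / 2, 1 / 2:])
    in degree H = n * (n + 1) \<and>
       Polynomial.coeff H (n * (n + 1)) =
         (-1) ^ ((n + 1) choose 2) *
         (\<Prod>j = 1..n. fact j ^ 6 / (fact (2 * j) * fact (2 * j + 1)))"
proof -
  let ?c = "(-1) ^ ((n + 1) choose 2) *
    (\<Prod>j = 1..n. fact j ^ 6 / (fact (2 * j) * fact (2 * j + 1))) :: real"
  have "Polynomial.coeff (hankel_det n shifted_moment) (n * (n + 1)) = ?c"
    unfolding degree_coeff_hankel_det(2)[OF degree_shifted_moment] coeff_shifted_moment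
      bernoulli.hankel_det_shift[of n "1 / 2"] by (rule hankel_det_bernoulli_number)
  \<comment> \<open>Nonvanishing makes the degree bound sharp.\<close>
  moreover have "?c \<noteq> 0"
    by simp
  moreover have "degree (hankel_det n shifted_moment) \<le> n * (n + 1)"
    by (rule degree_coeff_hankel_det(1)[OF degree_shifted_moment])
  ultimately show ?thesis
    unfolding hankel_det_shifted_moment Let_def by (metis le_antisym le_degree)
qed

end
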